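(* Let $p$ be a prime, $g>1$ an integer, $q=p^g$, $G=GL_2(\mathbb{F}_q)$, and fix non-negative integers $k_0,\dots,k_{g-1}$. For any integers $\alpha,\beta$ with $0\le\alpha\le g-1$ and $1\le\beta\le g-1$, the operators $\Theta_\beta^{[\alpha]}$ and $\Theta^{[\alpha]}$ (multiplication by $X\otimes Y^{p^{g-\beta}}-Y\otimes X^{p^{g-\beta}}$ on the tensor factors of index $\alpha$ and $\alpha+\beta$, respectively multiplication by $XY^q-X^qY$ on the tensor factor of index $\alpha$) are pairwise commuting injective $G$-intertwining operators as follows: $$\Theta_\beta^{[\alpha]}:\ \det\nolimits^{p^\alpha}\otimes\bigotimes_iM_{k_i}^{[i]}\longrightarrow\Big(\bigotimes_{i\ne\alpha,\alpha+\beta}M_{k_i}^{[i]}\Big)\otimes M_{k_\alpha+1}^{[\alpha]}\otimes M_{k_{\alpha+\beta}+p^{g-\beta}}^{[\alpha+\beta]},$$ $$\Theta^{[\alpha]}:\ \det\nolimits^{p^\alpha}\otimes\bigotimes_iM_{k_i}^{[i]}\longrightarrow\Big(\bigotimes_{i\ne\alpha}M_{k_i}^{[i]}\Big)\otimes M_{k_\alpha+(q+1)}^{[\alpha]},$$ where the tensor product indices run over the integers $i$ with $0\le i\le g-1$, unless otherwise specified.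
   Context: All tensor products are over $\mathbb{F}_q$. For $k\ge0$, $M_k$ is the space of homogeneous polynomials of degree $k$ in $\mathbb{F}_q[X,Y]$, with $G$ acting by $\begin{pmatrix}a&b\\c&d\end{pmatrix}X=aX+cY$, $\begin{pmatrix}a&b\\c&d\end{pmatrix}Y=bX+dY$ (extended multiplicatively). $M^{[n]}$ denotes the $n$-th Frobenius twist of a $G$-module $M$: the action is precomposed with the automorphism of $G$ applying the $n$-th power of $x\mapsto x^p$ to matrix entries. Indices such as $\alpha+\beta$ are read modulo $g$ in the range $\{0,\dots,g-1\}$, and tensor products differing only in the order of their factors are identified. The generalized Dickson operator $\Theta_\beta^{[\alpha]}$ is the element $X\otimes Y^{p^{g-\beta}}-Y\otimes X^{p^{g-\beta}}$ of $M_1^{[\alpha]}\otimes M_{p^{g-\beta}}^{[\alpha+\beta]}$; the same symbol denotes multiplication by it in the algebra $\mathbb{F}_q[X,Y]^{[\alpha]}\otimes\mathbb{F}_q[X,Y]^{[\alpha+\beta]}$, extended by the identity on the remaining tensor factors. $\Theta^{[\alpha]}$ is the element $XY^q-X^qY$ of $M_{q+1}^{[\alpha]}$; the same symbol denotes multiplication by it in $\mathbb{F}_q[X,Y]^{[\alpha]}$, extended by the identity on the remaining tensor factors. *)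

theory Defs
  imports
    "HOL-Analysis.Determinants"
    "HOL-Computational_Algebra.Polynomial"
    "HOL-Library.Poly_Mapping"
    "HOL-Library.FuncSet"
begin

record ('k, 'g, 'v) rep =
  rep_space :: "'v set"
  rep_add :: "'v \<Rightarrow> 'v \<Rightarrow> 'v"
  rep_scale :: "'k \<Rightarrow> 'v \<Rightarrow> 'v"
  rep_act :: "'g \<Rightarrow> 'v \<Rightarrow> 'v"

definition intertwining ::
    "'g set \<Rightarrow> ('k, 'g, 'v) rep \<Rightarrow> ('k, 'g, 'w) rep \<Rightarrow> ('v \<Rightarrow> 'w) \<Rightarrow> bool" where
  "intertwining G V W T \<longleftrightarrow>
     (\<forall>x\<in>rep_space V. T x \<in> rep_space W) \<and>
     (\<forall>x\<in>rep_space V. \<forall>y\<in>rep_space V. T (rep_add V x y) = rep_add W (T x) (T y)) \<and>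
     (\<forall>c. \<forall>x\<in>rep_space V. T (rep_scale V c x) = rep_scale W c (T x)) \<and>
     (\<forall>A\<in>G. \<forall>x\<in>rep_space V. T (rep_act V A x) = rep_act W A (T x))"

text \<open>
  The tensor product of \<open>V i\<close>, \<open>i \<in> I\<close>, is the free vector space on the product set
  \<open>\<Pi>\<^sub>E i\<in>I. V i\<close> modulo the subspace spanned by the multilinearity relations. Its elements are
  equivalence classes. Being indexed by a set, it does not depend on an order of the factors.
\<close>

definition free_scale :: "'k::field \<Rightarrow> ('b \<Rightarrow>\<^sub>0 'k) \<Rightarrow> ('b \<Rightarrow>\<^sub>0 'k)" where
  "free_scale c P = Poly_Mapping.map ((*) c) P"

lemma lookup_free_scale [simp]:
  "Poly_Mapping.lookup (free_scale c P) b = c * Poly_Mapping.lookup P b"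
  by (simp add: free_scale_def Poly_Mapping.map.rep_eq when_def)

interpretation free: vector_space free_scale
  by unfold_locales (auto intro!: poly_mapping_eqI simp: lookup_add algebra_simps)

definition free_space ::
    "'i set \<Rightarrow> ('i \<Rightarrow> ('k::field, 'g, 'v) rep) \<Rightarrow> (('i \<Rightarrow> 'v) \<Rightarrow>\<^sub>0 'k) set" where
  "free_space I V = {P. Poly_Mapping.keys P \<subseteq> (\<Pi>\<^sub>E i\<in>I. rep_space (V i))}"

definition gen :: "'b \<Rightarrow> ('b \<Rightarrow>\<^sub>0 'k::field)" where
  "gen b = Poly_Mapping.single b 1"

definition multilinear_rels ::
    "'i set \<Rightarrow> ('i \<Rightarrow> ('k::field, 'g, 'v) rep) \<Rightarrow> (('i \<Rightarrow> 'v) \<Rightarrow>\<^sub>0 'k) set" where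
  "multilinear_rels I V =
     {gen (f(i := rep_add (V i) x y)) - gen (f(i := x)) - gen (f(i := y)) | f i x y.
        f \<in> (\<Pi>\<^sub>E i\<in>I. rep_space (V i)) \<and> i \<in> I \<and> x \<in> rep_space (V i) \<and> y \<in> rep_space (V i)} \<union>
     {gen (f(i := rep_scale (V i) c x)) - free_scale c (gen (f(i := x))) | f i c x.
        f \<in> (\<Pi>\<^sub>E i\<in>I. rep_space (V i)) \<and> i \<in> I \<and> x \<in> rep_space (V i)}"

definition tensor_eq ::
    "'i set \<Rightarrow> ('i \<Rightarrow> ('k::field, 'g, 'v) rep) \<Rightarrow> (('i \<Rightarrow> 'v) \<Rightarrow>\<^sub>0 'k) rel" where
  "tensor_eq I V =
     {(P, Q). P \<in> free_space I V \<and> Q \<in> free_space I V \<and> P - Q \<in> free.span (multilinear_rels I V)}"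

definition free_map :: "('b \<Rightarrow> 'c) \<Rightarrow> ('b \<Rightarrow>\<^sub>0 'k::field) \<Rightarrow> ('c \<Rightarrow>\<^sub>0 'k)" where
  "free_map \<phi> P =
     (\<Sum>f\<in>Poly_Mapping.keys P. Poly_Mapping.single (\<phi> f) (Poly_Mapping.lookup P f))"

definition tensor_rep ::
    "'i set \<Rightarrow> ('i \<Rightarrow> ('k::field, 'g, 'v) rep) \<Rightarrow> ('k, 'g, (('i \<Rightarrow> 'v) \<Rightarrow>\<^sub>0 'k) set) rep" where
  "tensor_rep I V = \<lparr>
     rep_space = free_space I V // tensor_eq I V,
     rep_add = (\<lambda>C D. \<Union>P\<in>C. \<Union>Q\<in>D. tensor_eq I V `` {P + Q}),
     rep_scale = (\<lambda>c C. \<Union>P\<in>C. tensor_eq I V `` {free_scale c P}),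
     rep_act = (\<lambda>A C. \<Union>P\<in>C. tensor_eq I V `` {free_map (\<lambda>f. \<lambda>i\<in>I. rep_act (V i) A (f i)) P})\<rparr>"

text \<open>
  Factorwise multiplication \<open>(\<Otimes>\<^sub>i U i) \<times> (\<Otimes>\<^sub>i V i) \<rightarrow> \<Otimes>\<^sub>i W i\<close> of tensors, for subspaces
  \<open>U i\<close>, \<open>V i\<close>, \<open>W i\<close> of an algebra with \<open>U i \<cdot> V i \<subseteq> W i\<close>.
\<close>

definition free_mult ::
    "'i set \<Rightarrow> (('i \<Rightarrow> 'v::times) \<Rightarrow>\<^sub>0 'k::field) \<Rightarrow> (('i \<Rightarrow> 'v) \<Rightarrow>\<^sub>0 'k) \<Rightarrow> (('i \<Rightarrow> 'v) \<Rightarrow>\<^sub>0 'k)" where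
  "free_mult I P Q =
     (\<Sum>f\<in>Poly_Mapping.keys P. \<Sum>h\<in>Poly_Mapping.keys Q.
        Poly_Mapping.single (\<lambda>i\<in>I. f i * h i) (Poly_Mapping.lookup P f * Poly_Mapping.lookup Q h))"

definition tensor_mult ::
    "'i set \<Rightarrow> ('i \<Rightarrow> ('k::field, 'g, 'v::times) rep) \<Rightarrow>
     (('i \<Rightarrow> 'v) \<Rightarrow>\<^sub>0 'k) set \<Rightarrow> (('i \<Rightarrow> 'v) \<Rightarrow>\<^sub>0 'k) set \<Rightarrow> (('i \<Rightarrow> 'v) \<Rightarrow>\<^sub>0 'k) set" where
  "tensor_mult I W C D = (\<Union>P\<in>C. \<Union>Q\<in>D. tensor_eq I W `` {free_mult I P Q})"

text \<open>
  \<open>'a poly poly\<close> is the ring of polynomials in \<open>X\<close>, \<open>Y\<close>, with \<open>coeff (coeff P j) i\<close> the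
  coefficient of \<open>X\<^sup>i Y\<^sup>j\<close>.
\<close>

definition polyX :: "'a::field poly poly" where
  "polyX = [:[:0, 1:]:]"

definition polyY :: "'a::field poly poly" where
  "polyY = [:0, 1:]"

definition const_poly :: "'a::field \<Rightarrow> 'a poly poly" where
  "const_poly c = [:[:c:]:]"

text \<open>The value of \<open>P\<close> under \<open>X \<mapsto> U\<close>, \<open>Y \<mapsto> V\<close>.\<close>

definition subst_XY :: "'a::field poly poly \<Rightarrow> 'a poly poly \<Rightarrow> 'a poly poly \<Rightarrow> 'a poly poly" where
  "subst_XY U V P = poly (map_poly (\<lambda>c. poly (map_poly const_poly c) U) P) V"

definition GL2 :: "('a::field ^ 2 ^ 2) set" where
  "GL2 = {A. invertible A}"

definition hom_rep :: "nat \<Rightarrow> ('a::field, 'a ^ 2 ^ 2, 'a poly poly) rep" where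
  "hom_rep k = \<lparr>
     rep_space = {P. \<forall>i j. coeff (coeff P j) i \<noteq> 0 \<longrightarrow> i + j = k},
     rep_add = (+),
     rep_scale = (\<lambda>c P. const_poly c * P),
     rep_act = (\<lambda>A. subst_XY (const_poly (A$1$1) * polyX + const_poly (A$2$1) * polyY)
                           (const_poly (A$1$2) * polyX + const_poly (A$2$2) * polyY))\<rparr>"

definition frob_twist ::
    "nat \<Rightarrow> nat \<Rightarrow> ('k, 'a::field ^ 2 ^ 2, 'v) rep \<Rightarrow> ('k, 'a ^ 2 ^ 2, 'v) rep" where
  "frob_twist p n V = V\<lparr>rep_act := (\<lambda>A. rep_act V (\<chi> i j. ((\<lambda>x. x ^ p) ^^ n) (A$i$j)))\<rparr>"

text \<open>\<open>det\<^sup>n \<otimes> V\<close>, realised on the space of \<open>V\<close> via \<open>1 \<otimes> v \<mapsto> v\<close>.\<close>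

definition det_twist ::
    "nat \<Rightarrow> ('a::field, 'a ^ 2 ^ 2, 'v) rep \<Rightarrow> ('a, 'a ^ 2 ^ 2, 'v) rep" where
  "det_twist n V = V\<lparr>rep_act := (\<lambda>A v. rep_scale V (det A ^ n) (rep_act V A v))\<rparr>"

definition twisted_M :: "nat \<Rightarrow> (nat \<Rightarrow> nat) \<Rightarrow> nat \<Rightarrow> ('a::field, 'a ^ 2 ^ 2, 'a poly poly) rep" where
  "twisted_M p k i = frob_twist p i (hom_rep (k i))"

type_synonym 'a tensor = "((nat \<Rightarrow> 'a poly poly) \<Rightarrow>\<^sub>0 'a) set"

definition tensor_M ::
    "nat \<Rightarrow> nat \<Rightarrow> (nat \<Rightarrow> nat) \<Rightarrow> ('a::field, 'a ^ 2 ^ 2, 'a tensor) rep" where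
  "tensor_M p g k = tensor_rep {..<g} (twisted_M p k)"

text \<open>
  The degrees of the factors after applying \<open>\<Theta>\<^sub>\<beta>\<^sup>[\<^sup>\<alpha>\<^sup>]\<close>, respectively \<open>\<Theta>\<^sup>[\<^sup>\<alpha>\<^sup>]\<close>, to a tensor with
  factors of degrees \<open>k\<close>. Starting from \<open>k = 0\<close> these are the degrees of the Dickson elements
  themselves, whose factors outside \<open>\<alpha>\<close>, \<open>\<alpha> + \<beta>\<close> are \<open>1\<close>.
\<close>

definition Theta2_deg :: "nat \<Rightarrow> nat \<Rightarrow> nat \<Rightarrow> nat \<Rightarrow> (nat \<Rightarrow> nat) \<Rightarrow> (nat \<Rightarrow> nat)" where
  "Theta2_deg p g \<alpha> \<beta> k =
     k(\<alpha> := k \<alpha> + 1, (\<alpha> + \<beta>) mod g := k ((\<alpha> + \<beta>) mod g) + p ^ (g - \<beta>))"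

definition Theta1_deg :: "nat \<Rightarrow> nat \<Rightarrow> nat \<Rightarrow> (nat \<Rightarrow> nat) \<Rightarrow> (nat \<Rightarrow> nat)" where
  "Theta1_deg p g \<alpha> k = k(\<alpha> := k \<alpha> + (p ^ g + 1))"

definition Theta2_elt :: "nat \<Rightarrow> nat \<Rightarrow> nat \<Rightarrow> nat \<Rightarrow> 'a::field tensor" where
  "Theta2_elt p g \<alpha> \<beta> =
     tensor_eq {..<g} (twisted_M p (Theta2_deg p g \<alpha> \<beta> (\<lambda>_. 0)) :: _ \<Rightarrow> ('a, 'a ^ 2 ^ 2, _) rep) ``
       {gen (\<lambda>i\<in>{..<g}. if i = \<alpha> then polyX else if i = (\<alpha> + \<beta>) mod g then polyY ^ p ^ (g - \<beta>) else 1) -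
        gen (\<lambda>i\<in>{..<g}. if i = \<alpha> then polyY else if i = (\<alpha> + \<beta>) mod g then polyX ^ p ^ (g - \<beta>) else 1)}"

definition Theta1_elt :: "nat \<Rightarrow> nat \<Rightarrow> nat \<Rightarrow> 'a::field tensor" where
  "Theta1_elt p g \<alpha> =
     tensor_eq {..<g} (twisted_M p (Theta1_deg p g \<alpha> (\<lambda>_. 0)) :: _ \<Rightarrow> ('a, 'a ^ 2 ^ 2, _) rep) ``
       {gen (\<lambda>i\<in>{..<g}. if i = \<alpha> then polyX * polyY ^ p ^ g - polyX ^ p ^ g * polyY else 1)}"

text \<open>
  \<open>Theta2 p g \<alpha> \<beta> k\<close> is \<open>\<Theta>\<^sub>\<beta>\<^sup>[\<^sup>\<alpha>\<^sup>]\<close> and \<open>Theta1 p g \<alpha> k\<close> is \<open>\<Theta>\<^sup>[\<^sup>\<alpha>\<^sup>]\<close>, on tensors with factors of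
  degrees \<open>k\<close>.
\<close>

definition Theta2 ::
    "nat \<Rightarrow> nat \<Rightarrow> nat \<Rightarrow> nat \<Rightarrow> (nat \<Rightarrow> nat) \<Rightarrow> 'a::field tensor \<Rightarrow> 'a tensor" where
  "Theta2 p g \<alpha> \<beta> k =
     tensor_mult {..<g} (twisted_M p (Theta2_deg p g \<alpha> \<beta> k) :: _ \<Rightarrow> ('a, 'a ^ 2 ^ 2, _) rep)
       (Theta2_elt p g \<alpha> \<beta>)"

definition Theta1 ::
    "nat \<Rightarrow> nat \<Rightarrow> nat \<Rightarrow> (nat \<Rightarrow> nat) \<Rightarrow> 'a::field tensor \<Rightarrow> 'a tensor" where
  "Theta1 p g \<alpha> k =
     tensor_mult {..<g} (twisted_M p (Theta1_deg p g \<alpha> k) :: _ \<Rightarrow> ('a, 'a ^ 2 ^ 2, _) rep)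
       (Theta1_elt p g \<alpha>)"

end

theory Submission
  imports Defs
begin

text \<open>
  Sending \<open>X \<mapsto> x\<^sub>i\<close>, \<open>Y \<mapsto> 1\<close> on the \<open>i\<close>-th factor and multiplying the results embeds the
  tensor product into the polynomial ring over \<open>F\<^sub>q\<close> in the variables \<open>x\<^sub>i\<close>: every tensor is a
  combination of monomial tensors, and these go to distinct monomials because the degree of each
  factor is fixed. The factorwise product becomes multiplication in an integral domain, which yields
  commutativity and, since the Dickson elements go to \<open>x\<^sub>\<alpha> - x\<^sub>\<gamma> ^ n\<close> with \<open>\<gamma> \<noteq> \<alpha>\<close> or
  \<open>n > 1\<close>, injectivity. The group acts by ring automorphisms on each factor, so equivariance reduces
  to the Dickson elements being multiplied by \<open>det A ^ p ^ \<alpha>\<close>, a two-by-two determinant computation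
  based on \<open>(u + v) ^ p = u ^ p + v ^ p\<close> and \<open>a ^ q = a\<close>.
\<close>

section \<open>Unital ring homomorphisms and substitution\<close>

locale unital_ring_hom =
  fixes h :: "'b::comm_ring_1 \<Rightarrow> 'c::comm_ring_1"
  assumes hom_add: "h (x + y) = h x + h y"
    and hom_mult: "h (x * y) = h x * h y"
    and hom_one: "h 1 = 1"
begin

lemma hom_zero: "h 0 = 0"
  using hom_add[of 0 0] by simp

lemma hom_diff: "h (x - y) = h x - h y"
  using hom_add[of "x - y" y] by simp

lemma hom_power: "h (x ^ n) = h x ^ n"
  by (induction n) (simp_all add: hom_one hom_mult)

end

lemma unital_ring_hom_comp:
  assumes "unital_ring_hom h1" "unital_ring_hom h2"
  shows "unital_ring_hom (\<lambda>x. h1 (h2 x))"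
  using assms by (simp add: unital_ring_hom_def)

lemma unital_ring_hom_poly_eval: "unital_ring_hom (\<lambda>p. poly p u)"
  by unfold_locales auto

text \<open>Substitution and dehomogenisation are both evaluations of this shape. The Horner
  recursion \<open>pc\<close> turns additivity, compatibility with scalars and multiplicativity into
  inductions on coefficient lists.\<close>

lemma unital_ring_hom_poly_map:
  assumes "unital_ring_hom h"
  shows "unital_ring_hom (\<lambda>p. poly (map_poly h p) u)"
proof -
  interpret unital_ring_hom h by fact
  let ?F = "\<lambda>p. poly (map_poly h p) u"
  have pc: "?F (pCons a p) = h a + u * ?F p" for a p
    by (simp add: map_poly_pCons hom_zero)
  have add: "?F (p + q) = ?F p + ?F q" for p q
    by (induction p q rule: poly_induct2) (simp_all add: pc hom_add algebra_simps)
  have smult: "?F (smult c q) = h c * ?F q" for c q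
    by (induction q) (simp_all add: pc hom_mult algebra_simps)
  have "?F (p * q) = ?F p * ?F q" for p q
    by (induction p) (simp_all add: pc add smult hom_zero algebra_simps)
  then show ?thesis
    by unfold_locales (simp_all add: add hom_one)
qed

lemma unital_ring_hom_const_poly: "unital_ring_hom const_poly"
  by unfold_locales (simp_all add: const_poly_def one_pCons)

lemma unital_ring_hom_subst_XY: "unital_ring_hom (subst_XY U V)"
  unfolding subst_XY_def
  by (intro unital_ring_hom_poly_map unital_ring_hom_const_poly)

lemma const_poly_0 [simp]: "const_poly 0 = 0"
  by (simp add: const_poly_def)

lemma const_poly_1 [simp]: "const_poly 1 = 1"
  by (simp add: const_poly_def one_pCons)

lemma subst_XY_const [simp]: "subst_XY U V (const_poly c) = const_poly c"
  by (simp add: subst_XY_def const_poly_def map_poly_pCons)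

lemma subst_XY_polyX [simp]: "subst_XY U V polyX = U"
  by (simp add: subst_XY_def polyX_def map_poly_pCons)

lemma subst_XY_polyY [simp]: "subst_XY U V polyY = V"
  by (simp add: subst_XY_def polyY_def map_poly_pCons)

section \<open>Homogeneous polynomials\<close>

definition homog :: "nat \<Rightarrow> 'a::field poly poly set" where
  "homog n = {P. \<forall>i j. coeff (coeff P j) i \<noteq> 0 \<longrightarrow> i + j = n}"

text \<open>The outer degree counts Y and the inner one X. For \<open>a > n\<close> the truncated
  subtraction gives X^a, which is not of degree n; hence the bounds \<open>a \<le> n\<close>
  below.\<close>

definition mono_XY :: "nat \<Rightarrow> nat \<Rightarrow> 'a::field poly poly" where
  "mono_XY n a = monom (monom 1 a) (n - a)"

lemma mono_XY_eq: "mono_XY n a = polyX ^ a * polyY ^ (n - a)"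
proof -
  have X: "polyX ^ a = (monom (monom 1 a) 0 :: 'a poly poly)"
    by (simp add: polyX_def monom_0 poly_const_pow monom_altdef flip: one_pCons)
  have Y: "polyY ^ b = (monom 1 b :: 'a poly poly)" for b
    by (simp add: polyY_def monom_altdef)
  show ?thesis by (simp add: X Y mono_XY_def mult_monom)
qed

lemma const_mult_monom: "const_poly c * monom (monom b i) j = monom (monom (c * b) i) j"
  by (simp add: const_poly_def smult_monom)

lemma homog_add: "P \<in> homog n \<Longrightarrow> Q \<in> homog n \<Longrightarrow> P + Q \<in> homog n"
  unfolding homog_def by (auto, metis add.right_neutral)

lemma homog_zero: "0 \<in> homog n"
  by (simp add: homog_def)

lemma homog_sum: "(\<And>x. x \<in> S \<Longrightarrow> P x \<in> homog n) \<Longrightarrow> sum P S \<in> homog n"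
  by (induction S rule: infinite_finite_induct) (simp_all add: homog_zero homog_add)

text \<open>A nonzero coefficient of the product needs a nonzero term in the double convolution, and
  the index pairs of that term add up to m and to n.\<close>

lemma homog_mult:
  assumes "P \<in> homog m" "Q \<in> homog n"
  shows "P * Q \<in> homog (m + n)"
  unfolding homog_def
proof (intro CollectI allI impI)
  fix i j
  assume "coeff (coeff (P * Q) j) i \<noteq> 0"
  then have "(\<Sum>s\<le>j. \<Sum>t\<le>i. coeff (coeff P s) t * coeff (coeff Q (j - s)) (i - t)) \<noteq> 0"
    by (simp add: coeff_mult coeff_sum)
  then obtain s where s: "s \<le> j"
      and "(\<Sum>t\<le>i. coeff (coeff P s) t * coeff (coeff Q (j - s)) (i - t)) \<noteq> 0"
    by (metis (no_types, lifting) atMost_iff sum.neutral)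
  then obtain t where t: "t \<le> i" and "coeff (coeff P s) t * coeff (coeff Q (j - s)) (i - t) \<noteq> 0"
    by (metis (no_types, lifting) atMost_iff sum.neutral)
  then have "t + s = m" "(i - t) + (j - s) = n"
    using assms by (auto simp: homog_def)
  then show "i + j = m + n" using s t by simp
qed

lemma homog_one: "1 \<in> homog 0"
  by (auto simp: homog_def one_pCons coeff_pCons split: nat.splits)

lemma homog_const: "const_poly c \<in> homog 0"
  by (auto simp: homog_def const_poly_def coeff_pCons split: nat.splits)

lemma homog_polyX: "polyX \<in> homog 1"
  by (auto simp: homog_def polyX_def coeff_pCons split: nat.splits)

lemma homog_polyY: "polyY \<in> homog 1"
  by (auto simp: homog_def polyY_def coeff_pCons one_pCons split: nat.splits)

lemma homog_scale: "P \<in> homog n \<Longrightarrow> const_poly c * P \<in> homog n"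
  using homog_mult[OF homog_const] by force

lemma homog_diff: "P \<in> homog n \<Longrightarrow> Q \<in> homog n \<Longrightarrow> P - Q \<in> homog n"
  unfolding homog_def by (auto, metis add.right_neutral diff_0_right)

lemma homog_power: "P \<in> homog n \<Longrightarrow> P ^ m \<in> homog (m * n)"
  by (induction m) (simp_all add: homog_one homog_mult)

lemma homog_mono_XY: "a \<le> n \<Longrightarrow> mono_XY n a \<in> homog n"
  using homog_mult[OF homog_power[OF homog_polyX, of a] homog_power[OF homog_polyY, of "n - a"]]
  by (simp add: mono_XY_eq)

text \<open>On the diagonal \<open>i + j = n\<close> only the term \<open>a = i\<close> has a
  coefficient at that place; off the diagonal both sides vanish by homogeneity.\<close>

lemma homog_expand:
  assumes "P \<in> homog n"
  shows "P = (\<Sum>a\<le>n. const_poly (coeff (coeff P (n - a)) a) * mono_XY n a)"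
proof -
  have "coeff (coeff P j) i =
      coeff (coeff (\<Sum>a\<le>n. const_poly (coeff (coeff P (n - a)) a) * mono_XY n a) j) i" for i j
  proof (cases "i + j = n")
    case True
    have "coeff (coeff (\<Sum>a\<le>n. const_poly (coeff (coeff P (n - a)) a) * mono_XY n a) j) i =
        (\<Sum>a\<le>n. if i = a then coeff (coeff P (n - a)) a else 0)"
      using True unfolding coeff_sum
      by (intro sum.cong refl) (auto simp: mono_XY_def const_mult_monom)
    then show ?thesis using True by auto
  next
    case False
    have "(\<Sum>a\<le>n. const_poly (coeff (coeff P (n - a)) a) * mono_XY n a) \<in> homog n"
      by (intro homog_sum homog_scale homog_mono_XY) simp
    then have "coeff (coeff (\<Sum>a\<le>n. const_poly (coeff (coeff P (n - a)) a) * mono_XY n a) j) i = 0"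
      using False unfolding homog_def by blast
    moreover have "coeff (coeff P j) i = 0"
      using False assms unfolding homog_def by blast
    ultimately show ?thesis by simp
  qed
  then show ?thesis by (intro poly_eqI)
qed

text \<open>After expansion into monomials each one becomes U^a V^(n-a), a product of n linear
  forms.\<close>

lemma homog_subst_XY:
  assumes "U \<in> homog 1" "V \<in> homog 1" "P \<in> homog n"
  shows "subst_XY U V P \<in> homog n"
proof -
  interpret unital_ring_hom "subst_XY U V" by (rule unital_ring_hom_subst_XY)
  have sum: "subst_XY U V (sum f S) = (\<Sum>a\<in>S. subst_XY U V (f a))" for f and S :: "nat set"
    by (induction S rule: infinite_finite_induct) (simp_all add: hom_zero hom_add)
  have "U ^ a * V ^ (n - a) \<in> homog n" if "a \<le> n" for a
    using homog_mult[OF homog_power[OF assms(1), of a] homog_power[OF assms(2), of "n - a"]] that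
    by simp
  then show ?thesis
    by (subst homog_expand[OF assms(3)])
       (auto simp: sum hom_mult hom_power mono_XY_eq intro!: homog_sum homog_scale)
qed

section \<open>Evaluation of free tensors in a polynomial ring\<close>

text \<open>Finitely supported exponent vectors as monomials: the polynomial ring in one variable
  per natural number, an integral domain over a field.\<close>

type_synonym 'a mpoly_ring = "(nat \<Rightarrow>\<^sub>0 nat) \<Rightarrow>\<^sub>0 'a"

abbreviation const_mpoly :: "'a::field \<Rightarrow> 'a mpoly_ring" where
  "const_mpoly \<equiv> Poly_Mapping.single 0"

definition var :: "nat \<Rightarrow> 'a::field mpoly_ring" where
  "var i = Poly_Mapping.single (Poly_Mapping.single i 1) 1"

lemma var_power: "var i ^ n = Poly_Mapping.single (Poly_Mapping.single i n) 1"
  by (induction n) (simp_all add: var_def mult_single flip: single_add)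

lemma unital_ring_hom_const_mpoly: "unital_ring_hom const_mpoly"
  by unfold_locales (simp_all add: single_add mult_single)

text \<open>\<open>poly P 1\<close> sets the outer variable Y to 1; the remaining polynomial in X is
  then read in the variable of the i-th factor.\<close>

definition dehom :: "nat \<Rightarrow> 'a::field poly poly \<Rightarrow> 'a mpoly_ring" where
  "dehom i P = poly (map_poly const_mpoly (poly P 1)) (var i)"

lemma unital_ring_hom_dehom: "unital_ring_hom (dehom i)"
  unfolding dehom_def
  by (rule unital_ring_hom_comp[OF unital_ring_hom_poly_map[OF unital_ring_hom_const_mpoly]
        unital_ring_hom_poly_eval])

lemma dehom_const [simp]: "dehom i (const_poly c) = const_mpoly c"
  by (simp add: dehom_def const_poly_def map_poly_pCons)

lemma dehom_polyX [simp]: "dehom i polyX = var i"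
  by (simp add: dehom_def polyX_def map_poly_pCons)

lemma dehom_polyY [simp]: "dehom i polyY = 1"
  by (simp add: dehom_def polyY_def map_poly_pCons)

lemma dehom_mono_XY: "dehom i (mono_XY n a) = Poly_Mapping.single (Poly_Mapping.single i a) 1"
proof -
  interpret unital_ring_hom "dehom i" by (rule unital_ring_hom_dehom)
  show ?thesis by (simp add: mono_XY_eq hom_mult hom_power var_power)
qed

text \<open>The family \<open>h\<close> is left open so that the same facts serve for
  \<open>dehom\<close> and for \<open>dehom\<close> preceded by the group action.\<close>

definition tensor_eval ::
    "nat set \<Rightarrow> (nat \<Rightarrow> 'v \<Rightarrow> 'a::field mpoly_ring) \<Rightarrow> ((nat \<Rightarrow> 'v) \<Rightarrow>\<^sub>0 'a) \<Rightarrow> 'a mpoly_ring" where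
  "tensor_eval I h P =
     (\<Sum>f\<in>Poly_Mapping.keys P. const_mpoly (Poly_Mapping.lookup P f) * (\<Prod>i\<in>I. h i (f i)))"

lemma tensor_eval_zero [simp]: "tensor_eval I h 0 = 0"
  by (simp add: tensor_eval_def)

lemma tensor_eval_add: "tensor_eval I h (P + Q) = tensor_eval I h P + tensor_eval I h Q"
  unfolding tensor_eval_def
  by (rule setsum_keys_plus_distrib) (simp_all add: single_add algebra_simps)

lemma tensor_eval_diff: "tensor_eval I h (P - Q) = tensor_eval I h P - tensor_eval I h Q"
  using tensor_eval_add[of I h "P - Q" Q] by simp

lemma tensor_eval_sum: "tensor_eval I h (sum P S) = (\<Sum>x\<in>S. tensor_eval I h (P x))"
  by (induction S rule: infinite_finite_induct) (simp_all add: tensor_eval_add)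

lemma tensor_eval_single:
  "tensor_eval I h (Poly_Mapping.single f c) = const_mpoly c * (\<Prod>i\<in>I. h i (f i))"
  by (cases "c = 0") (simp_all add: tensor_eval_def)

lemma tensor_eval_gen: "tensor_eval I h (gen f) = (\<Prod>i\<in>I. h i (f i))"
  by (simp add: gen_def tensor_eval_single)

lemma free_expand:
  "P = (\<Sum>f\<in>Poly_Mapping.keys P. free_scale (Poly_Mapping.lookup P f) (gen f))"
  by (rule poly_mapping_eqI)
     (auto simp: lookup_sum gen_def lookup_single when_def in_keys_iff if_distrib sum.delta
       cong: if_cong)

text \<open>A nonzero scalar keeps the set of keys, so the sums agree term by term; a zero scalar
  empties it and is treated apart.\<close>

lemma tensor_eval_scale:
  "tensor_eval I h (free_scale c P) = const_mpoly c * tensor_eval I h P"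
proof (cases "c = 0")
  case True
  then show ?thesis by simp
next
  case False
  then have "Poly_Mapping.keys (free_scale c P) = Poly_Mapping.keys P"
    by (auto simp: in_keys_iff)
  then show ?thesis
    by (simp add: tensor_eval_def sum_distrib_left mult_single flip: mult.assoc)
qed

text \<open>Each pair of keys contributes a product over I that splits by multiplicativity of
  \<open>h i\<close>, so the double sum factors.\<close>

lemma tensor_eval_free_mult:
  assumes "\<And>i. unital_ring_hom (h i)"
  shows "tensor_eval I h (free_mult I P Q) = tensor_eval I h P * tensor_eval I h Q"
proof -
  have "(\<Prod>i\<in>I. h i ((\<lambda>i\<in>I. f i * f' i) i)) = (\<Prod>i\<in>I. h i (f i)) * (\<Prod>i\<in>I. h i (f' i))" for f f'
    by (simp add: unital_ring_hom.hom_mult[OF assms] flip: prod.distrib)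
  then have "tensor_eval I h (free_mult I P Q) =
      (\<Sum>f\<in>Poly_Mapping.keys P. \<Sum>f'\<in>Poly_Mapping.keys Q.
        (const_mpoly (Poly_Mapping.lookup P f) * (\<Prod>i\<in>I. h i (f i))) *
        (const_mpoly (Poly_Mapping.lookup Q f') * (\<Prod>i\<in>I. h i (f' i))))"
    unfolding free_mult_def tensor_eval_sum tensor_eval_single
    by (simp add: unital_ring_hom.hom_mult[OF unital_ring_hom_const_mpoly] mult_ac)
  then show ?thesis
    by (simp add: tensor_eval_def sum_product)
qed

text \<open>Different keys may be sent to the same tuple; additivity of the evaluation over single
  terms accounts for the merged coefficients.\<close>

lemma tensor_eval_free_map:
  "tensor_eval I h (free_map (\<lambda>f. \<lambda>i\<in>I. \<phi> i (f i)) P) = tensor_eval I (\<lambda>i x. h i (\<phi> i x)) P"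
  by (simp add: free_map_def tensor_eval_sum tensor_eval_single)
     (simp add: tensor_eval_def)

section \<open>The tensor product as a subspace of a polynomial ring\<close>

lemma frob_funpow: "((\<lambda>x. x ^ p) ^^ n) (a::'a::field) = a ^ (p ^ n)"
  by (induction n) (simp_all add: mult.commute flip: power_mult)

definition twisted_subst :: "nat \<Rightarrow> nat \<Rightarrow> 'a::field ^ 2 ^ 2 \<Rightarrow> 'a poly poly \<Rightarrow> 'a poly poly" where
  "twisted_subst p i A =
     subst_XY (const_poly ((A$1$1) ^ p ^ i) * polyX + const_poly ((A$2$1) ^ p ^ i) * polyY)
              (const_poly ((A$1$2) ^ p ^ i) * polyX + const_poly ((A$2$2) ^ p ^ i) * polyY)"

lemma twisted_M_simps [simp]:
  "rep_space (twisted_M p k i) = homog (k i)"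
  "rep_add (twisted_M p k i) = (+)"
  "rep_scale (twisted_M p k i) c P = const_poly c * P"
  "rep_act (twisted_M p k i) A = twisted_subst p i A"
  by (simp_all add: twisted_M_def frob_twist_def hom_rep_def homog_def twisted_subst_def frob_funpow)

lemma homog_twisted_subst: "P \<in> homog n \<Longrightarrow> twisted_subst p i A P \<in> homog n"
  unfolding twisted_subst_def
  by (intro homog_subst_XY homog_add homog_scale homog_polyX homog_polyY)

lemma unital_ring_hom_twisted_subst: "unital_ring_hom (twisted_subst p i A)"
  unfolding twisted_subst_def by (rule unital_ring_hom_subst_XY)

lemma prod_fun_upd:
  fixes h :: "'i \<Rightarrow> 'v \<Rightarrow> 'c::comm_monoid_mult"
  assumes "finite I" "i \<in> I"
  shows "(\<Prod>j\<in>I. h j ((f(i := v)) j)) = h i v * (\<Prod>j\<in>I - {i}. h j (f j))"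
  by (subst prod.remove[OF assms]) (auto intro!: arg_cong2[where f = "(*)"] prod.cong)

text \<open>The product over I is linear in each factor, because every \<open>h i\<close> is a ring
  homomorphism that fixes scalars. Hence the generating relations evaluate to zero, and so does
  their span.\<close>

lemma tensor_eval_span_rels:
  assumes "finite I" and h: "\<And>i. unital_ring_hom (h i)"
    and c: "\<And>i c. h i (const_poly c) = const_mpoly c"
    and "R \<in> free.span (multilinear_rels I (twisted_M p k))"
  shows "tensor_eval I h R = 0"
  using assms(4)
proof (induction rule: free.span_induct_alt)
  case base
  show ?case by simp
next
  case (step a R R')
  have "tensor_eval I h R = 0"
    using step(1) assms(1) unfolding multilinear_rels_def
    by (auto simp: tensor_eval_diff tensor_eval_gen tensor_eval_scale prod_fun_upd c
        unital_ring_hom.hom_add[OF h] unital_ring_hom.hom_mult[OF h] distrib_right mult.assoc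
        simp del: fun_upd_apply)
  with step show ?case by (simp add: tensor_eval_add tensor_eval_scale)
qed

definition monomial_tensors :: "nat set \<Rightarrow> (nat \<Rightarrow> nat) \<Rightarrow> (nat \<Rightarrow> 'a::field poly poly) set" where
  "monomial_tensors I k = (\<lambda>m. \<lambda>i\<in>I. mono_XY (k i) (m i)) ` (\<Pi>\<^sub>E i\<in>I. {..k i})"

text \<open>The set \<open>J\<close> contains the indices of the factors still to be expanded into monomials.\<close>

lemma gen_in_span_monomial_tensors:
  fixes k :: "nat \<Rightarrow> nat" and I :: "nat set" and p :: nat
  defines "S \<equiv> free.span (multilinear_rels I (twisted_M p k :: nat \<Rightarrow> ('a::field, _, _) rep) \<union>
    gen ` monomial_tensors I k)"
  assumes "finite J" "J \<subseteq> I" "f \<in> (\<Pi>\<^sub>E i\<in>I. homog (k i))"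
    and "\<forall>i\<in>I - J. f i \<in> mono_XY (k i) ` {..k i}"
  shows "gen f \<in> S"
  using assms(2-)
proof (induction J arbitrary: f)
  case empty
  then have "\<forall>i\<in>I. \<exists>a. a \<le> k i \<and> f i = mono_XY (k i) a" by blast
  then obtain m where m: "\<forall>i\<in>I. m i \<le> k i \<and> f i = mono_XY (k i) (m i)" by metis
  have "f = (\<lambda>i\<in>I. mono_XY (k i) (restrict m I i))"
    using m empty.prems(2) by (auto simp: PiE_def extensional_def restrict_def)
  moreover have "restrict m I \<in> (\<Pi>\<^sub>E i\<in>I. {..k i})" using m by auto
  ultimately have "f \<in> monomial_tensors I k" unfolding monomial_tensors_def by blast
  then show ?case unfolding S_def by (intro free.span_base) auto
next
  case (insert x J)
  have x: "x \<in> I" using insert.prems by auto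
  have upd: "f(x := v) \<in> (\<Pi>\<^sub>E i\<in>I. homog (k i))" if "v \<in> homog (k x)" for v
    using insert.prems(2) x that by (auto simp: PiE_def extensional_def Pi_def)
  \<comment> \<open>Once the factor at \<open>x\<close> is a monomial, only the indices in
    \<open>J\<close> remain to be expanded, so the induction hypothesis applies.\<close>
  have mono: "gen (f(x := mono_XY (k x) a)) \<in> S" if "a \<le> k x" for a
    by (rule insert.IH) (use insert.prems that homog_mono_XY[OF that] upd in auto)
  have scale: "gen (f(x := const_poly c * v)) \<in> S"
    if "v \<in> homog (k x)" "gen (f(x := v)) \<in> S" for c v
  proof -
    have "gen (f(x := const_poly c * v)) - free_scale c (gen (f(x := v))) \<in> S"
      unfolding S_def
      by (intro free.span_base UnI1)
         (use that x insert.prems(2) in \<open>unfold multilinear_rels_def, simp, blast\<close>)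
    from free.span_add[OF this[unfolded S_def] free.span_scale[OF that(2)[unfolded S_def], of c]]
    show ?thesis by (simp add: S_def)
  qed
  have add: "gen (f(x := u + v)) \<in> S"
    if "u \<in> homog (k x)" "v \<in> homog (k x)" "gen (f(x := u)) \<in> S" "gen (f(x := v)) \<in> S" for u v
  proof -
    have "gen (f(x := u + v)) - gen (f(x := u)) - gen (f(x := v)) \<in> S"
      unfolding S_def
      by (intro free.span_base UnI1)
         (use that x insert.prems(2) in \<open>unfold multilinear_rels_def, simp, blast\<close>)
    from free.span_add[OF free.span_add[OF this[unfolded S_def] that(3)[unfolded S_def]]
        that(4)[unfolded S_def]]
    show ?thesis by (simp add: S_def)
  qed
  \<comment> \<open>The zero polynomial is written as 0 times the monomial Y^(k x), so that the
    scalar relation covers it.\<close>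
  have zero: "gen (f(x := 0)) \<in> S"
    using scale[OF homog_mono_XY[of 0 "k x"] mono[of 0], of 0] by simp
  \<comment> \<open>Stated for every subset \<open>T\<close> of the exponents to allow induction on
    finite sets; the full range is the case used.\<close>
  have sum: "gen (f(x := (\<Sum>a\<in>T. const_poly (c a) * mono_XY (k x) a))) \<in> S"
    if "T \<subseteq> {..k x}" for T c
    using finite_subset[OF that finite_atMost] that
    by (induction T rule: finite_induct)
       (auto simp: zero intro!: add scale mono homog_sum homog_scale homog_mono_XY)
  have "f x \<in> homog (k x)" using insert.prems(2) x by auto
  from homog_expand[OF this] sum[OF subset_refl] have "gen (f(x := f x)) \<in> S" by metis
  then show ?case by simp
qed

lemma prod_single:
  "(\<Prod>i\<in>I. Poly_Mapping.single (e i) 1) = (Poly_Mapping.single (\<Sum>i\<in>I. e i) 1 :: 'a::field mpoly_ring)"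
  by (induction I rule: infinite_finite_induct) (simp_all add: mult_single)

text \<open>Distinct monomial tensors evaluate to distinct monomials, so each coefficient of
  \<open>Q\<close> can be read off from its evaluation.\<close>

lemma tensor_eval_monomial_tensors_inj:
  fixes Q :: "(nat \<Rightarrow> 'a::field poly poly) \<Rightarrow>\<^sub>0 'a"
  assumes "finite I" "Poly_Mapping.keys Q \<subseteq> monomial_tensors I k" "tensor_eval I dehom Q = 0"
  shows "Q = 0"
proof (rule ccontr)
  assume "Q \<noteq> 0"
  then obtain f0 where f0: "f0 \<in> Poly_Mapping.keys Q" by (meson ex_in_conv keys_eq_empty)
  have "\<exists>m \<in> (\<Pi>\<^sub>E i\<in>I. {..k i}). f = (\<lambda>i\<in>I. mono_XY (k i) (m i))" if "f \<in> Poly_Mapping.keys Q" for f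
    using that assms(2) unfolding monomial_tensors_def by blast
  then obtain m where m: "\<And>f. f \<in> Poly_Mapping.keys Q \<Longrightarrow> m f \<in> (\<Pi>\<^sub>E i\<in>I. {..k i})"
      "\<And>f. f \<in> Poly_Mapping.keys Q \<Longrightarrow> f = (\<lambda>i\<in>I. mono_XY (k i) (m f i))" by metis
  \<comment> \<open>The exponent vector of the monomial to which the tuple \<open>f\<close>
    evaluates.\<close>
  define e where "e f = (\<Sum>i\<in>I. Poly_Mapping.single i (m f i))" for f
  have e_lookup: "Poly_Mapping.lookup (e f) i = m f i" if "i \<in> I" for f i
    using that assms(1) unfolding e_def
    by (simp add: lookup_sum lookup_single when_def if_distrib sum.delta cong: if_cong)
  have e_inj: "f = f'" if "f \<in> Poly_Mapping.keys Q" "f' \<in> Poly_Mapping.keys Q" "e f = e f'" for f f'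
  proof -
    have "m f i = m f' i" if "i \<in> I" for i
      using that e_lookup \<open>e f = e f'\<close> by metis
    then have "(\<lambda>i\<in>I. mono_XY (k i) (m f i)) = (\<lambda>i\<in>I. mono_XY (k i) (m f' i) :: 'a poly poly)"
      by (intro restrict_ext) simp
    then show ?thesis using m(2) that by metis
  qed
  have "(\<Prod>i\<in>I. dehom i (f i)) = (Poly_Mapping.single (e f) 1 :: 'a mpoly_ring)"
    if "f \<in> Poly_Mapping.keys Q" for f
  proof -
    have "(\<Prod>i\<in>I. dehom i (f i)) =
        (\<Prod>i\<in>I. Poly_Mapping.single (Poly_Mapping.single i (m f i)) 1 :: 'a mpoly_ring)"
      by (subst m(2)[OF that]) (simp add: dehom_mono_XY)
    then show ?thesis by (simp add: e_def prod_single)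
  qed
  then have eval: "tensor_eval I dehom Q =
      (\<Sum>f\<in>Poly_Mapping.keys Q. Poly_Mapping.single (e f) (Poly_Mapping.lookup Q f))"
    by (simp add: tensor_eval_def mult_single)
  \<comment> \<open>By \<open>e_inj\<close>, the key \<open>f0\<close> alone contributes to the
    monomial \<open>e f0\<close>.\<close>
  have "Poly_Mapping.lookup (tensor_eval I dehom Q) (e f0) =
      (\<Sum>f\<in>Poly_Mapping.keys Q. if f = f0 then Poly_Mapping.lookup Q f else 0)"
    unfolding eval lookup_sum lookup_single
    by (intro sum.cong refl) (use e_inj f0 in \<open>auto simp: when_def\<close>)
  also have "\<dots> = Poly_Mapping.lookup Q f0" using f0 by simp
  finally show False using assms(3) f0 by (simp add: in_keys_iff)
qed

text \<open>Turns membership in a span into the support condition required by the injectivity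
  statement above.\<close>

lemma keys_span_gen:
  assumes "Q \<in> free.span (gen ` M)"
  shows "Poly_Mapping.keys Q \<subseteq> M"
  using assms
proof (induction rule: free.span_induct_alt)
  case base
  show ?case by simp
next
  case (step c R Q)
  have "Poly_Mapping.keys (free_scale c R) \<subseteq> Poly_Mapping.keys R" by (auto simp: in_keys_iff)
  moreover have "Poly_Mapping.keys R \<subseteq> M" using step by (auto simp: gen_def)
  ultimately show ?case using step keys_add[of "free_scale c R" Q] by blast
qed

text \<open>Split P into relations R and a combination Q of monomial tensors. R evaluates to zero,
  hence so does Q, and then Q itself is zero.\<close>

lemma tensor_eval_kernel:
  fixes P :: "(nat \<Rightarrow> 'a::field poly poly) \<Rightarrow>\<^sub>0 'a"
  assumes "finite I" "P \<in> free_space I (twisted_M p k)" "tensor_eval I dehom P = 0"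
  shows "P \<in> free.span (multilinear_rels I (twisted_M p k))"
proof -
  let ?R = "multilinear_rels I (twisted_M p k) :: ((nat \<Rightarrow> 'a poly poly) \<Rightarrow>\<^sub>0 'a) set"
  have "gen f \<in> free.span (?R \<union> gen ` monomial_tensors I k)" if "f \<in> Poly_Mapping.keys P" for f
    by (rule gen_in_span_monomial_tensors[of I]) (use assms that in \<open>auto simp: free_space_def\<close>)
  then have "P \<in> free.span (?R \<union> gen ` monomial_tensors I k)"
    by (subst free_expand) (intro free.span_sum free.span_scale)
  then obtain R Q where RQ: "P = R + Q" "R \<in> free.span ?R" "Q \<in> free.span (gen ` monomial_tensors I k)"
    unfolding free.span_Un by blast
  have "tensor_eval I dehom R = 0"
    by (rule tensor_eval_span_rels[OF assms(1) unital_ring_hom_dehom _ RQ(2)]) simp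
  then have "tensor_eval I dehom Q = 0" using RQ(1) assms(3) by (simp add: tensor_eval_add)
  then have "Q = 0" using tensor_eval_monomial_tensors_inj[OF assms(1) keys_span_gen[OF RQ(3)]] by blast
  then show ?thesis using RQ by simp
qed

section \<open>Operations on representatives and on tensor classes\<close>

lemma free_space_iff: "P \<in> free_space I (twisted_M p k) \<longleftrightarrow>
    Poly_Mapping.keys P \<subseteq> (\<Pi>\<^sub>E i\<in>I. homog (k i))"
  by (simp add: free_space_def)

lemma free_space_zero: "0 \<in> free_space I (twisted_M p k)"
  by (simp add: free_space_iff)

lemma free_space_add:
  "P \<in> free_space I (twisted_M p k) \<Longrightarrow> Q \<in> free_space I (twisted_M p k) \<Longrightarrow>
   P + Q \<in> free_space I (twisted_M p k)"
  unfolding free_space_iff using keys_add[of P Q] by blast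

lemma free_space_diff:
  "P \<in> free_space I (twisted_M p k) \<Longrightarrow> Q \<in> free_space I (twisted_M p k) \<Longrightarrow>
   P - Q \<in> free_space I (twisted_M p k)"
  unfolding free_space_iff using keys_diff[of P Q] by blast

lemma free_space_scale:
  "P \<in> free_space I (twisted_M p k) \<Longrightarrow> free_scale c P \<in> free_space I (twisted_M p k)"
  unfolding free_space_iff by (auto simp: in_keys_iff)

lemma free_space_single:
  "f \<in> (\<Pi>\<^sub>E i\<in>I. homog (k i)) \<Longrightarrow> Poly_Mapping.single f c \<in> free_space I (twisted_M p k)"
  by (simp add: free_space_iff)

lemma free_space_sum:
  "(\<And>x. x \<in> S \<Longrightarrow> P x \<in> free_space I (twisted_M p k)) \<Longrightarrow> sum P S \<in> free_space I (twisted_M p k)"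
  by (induction S rule: infinite_finite_induct) (simp_all add: free_space_zero free_space_add)

lemma free_space_map:
  assumes "P \<in> free_space I (twisted_M p k)"
  shows "free_map (\<lambda>f. \<lambda>i\<in>I. twisted_subst p i A (f i)) P \<in> free_space I (twisted_M p k)"
  unfolding free_map_def
proof (intro free_space_sum free_space_single)
  fix f assume "f \<in> Poly_Mapping.keys P"
  then have "f \<in> (\<Pi>\<^sub>E i\<in>I. homog (k i))" using assms by (auto simp: free_space_iff)
  then show "(\<lambda>i\<in>I. twisted_subst p i A (f i)) \<in> (\<Pi>\<^sub>E i\<in>I. homog (k i))"
    by (auto simp: PiE_iff intro!: homog_twisted_subst)
qed

lemma free_space_mult:
  assumes "P \<in> free_space I (twisted_M p d)" "Q \<in> free_space I (twisted_M p k)"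
    and "\<And>i. i \<in> I \<Longrightarrow> l i = d i + k i"
  shows "free_mult I P Q \<in> free_space I (twisted_M p l)"
  unfolding free_mult_def
proof (intro free_space_sum free_space_single)
  fix f h assume "f \<in> Poly_Mapping.keys P" "h \<in> Poly_Mapping.keys Q"
  then have "f \<in> (\<Pi>\<^sub>E i\<in>I. homog (d i))" "h \<in> (\<Pi>\<^sub>E i\<in>I. homog (k i))"
    using assms by (auto simp: free_space_iff)
  then show "(\<lambda>i\<in>I. f i * h i) \<in> (\<Pi>\<^sub>E i\<in>I. homog (l i))"
    by (auto simp: assms(3) PiE_iff intro!: homog_mult)
qed

text \<open>The kernel of the evaluation on \<open>free_space\<close> is exactly the span of the
  relations, so equality of tensors becomes equality of polynomials.\<close>

lemma tensor_eq_iff: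
  fixes P Q :: "(nat \<Rightarrow> 'a::field poly poly) \<Rightarrow>\<^sub>0 'a"
  assumes "finite I"
  shows "(P, Q) \<in> tensor_eq I (twisted_M p k) \<longleftrightarrow>
     P \<in> free_space I (twisted_M p k) \<and> Q \<in> free_space I (twisted_M p k) \<and>
     tensor_eval I dehom P = tensor_eval I dehom Q"
  using tensor_eval_kernel[OF assms free_space_diff, of P p k Q]
    tensor_eval_span_rels[OF assms, of dehom "P - Q" p k]
  by (auto simp: tensor_eq_def tensor_eval_diff unital_ring_hom_dehom)

lemma equiv_tensor_eq:
  "finite I \<Longrightarrow> equiv (free_space I (twisted_M p k)) (tensor_eq I (twisted_M p k))"
  by (auto simp: equiv_def refl_on_def sym_on_def trans_on_def tensor_eq_iff)

abbreviation tensor_class ::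
    "nat \<Rightarrow> nat \<Rightarrow> (nat \<Rightarrow> nat) \<Rightarrow> ((nat \<Rightarrow> 'a::field poly poly) \<Rightarrow>\<^sub>0 'a) \<Rightarrow> 'a tensor" where
  "tensor_class p g k P \<equiv> tensor_eq {..<g} (twisted_M p k) `` {P}"

abbreviation free_act ::
    "nat \<Rightarrow> nat \<Rightarrow> 'a::field ^ 2 ^ 2 \<Rightarrow> ((nat \<Rightarrow> 'a poly poly) \<Rightarrow>\<^sub>0 'a) \<Rightarrow>
     ((nat \<Rightarrow> 'a poly poly) \<Rightarrow>\<^sub>0 'a)" where
  "free_act p g A \<equiv> free_map (\<lambda>f. \<lambda>i\<in>{..<g}. twisted_subst p i A (f i))"

lemma unital_ring_hom_dehom_subst: "unital_ring_hom (\<lambda>x. dehom i (twisted_subst p i A x))"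
  by (rule unital_ring_hom_comp[OF unital_ring_hom_dehom unital_ring_hom_twisted_subst])

lemma twisted_subst_const [simp]: "twisted_subst p i A (const_poly c) = const_poly c"
  by (simp add: twisted_subst_def)

lemma tensor_eval_free_act:
  "tensor_eval {..<g} h (free_act p g A P) =
    tensor_eval {..<g} (\<lambda>i x. h i (twisted_subst p i A x)) P"
  by (rule tensor_eval_free_map)

lemma tensor_class_eq_iff:
  assumes "P \<in> free_space {..<g} (twisted_M p k)" "Q \<in> free_space {..<g} (twisted_M p k)"
  shows "tensor_class p g k P = tensor_class p g k Q \<longleftrightarrow>
    tensor_eval {..<g} dehom P = tensor_eval {..<g} dehom Q"
  using eq_equiv_class_iff[OF equiv_tensor_eq[OF finite_lessThan] assms] assms
  by (simp add: tensor_eq_iff)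

lemma tensor_class_eqI:
  assumes "P \<in> free_space {..<g} (twisted_M p k)" "Q \<in> free_space {..<g} (twisted_M p k)"
    and "tensor_eval {..<g} dehom P = tensor_eval {..<g} dehom Q"
  shows "tensor_class p g k P = tensor_class p g k Q"
  using assms tensor_class_eq_iff by blast

text \<open>
  Evaluation after the action is again an evaluation along ring homomorphisms, so it too
  vanishes on the multilinearity relations.
\<close>

lemma tensor_eval_act_cong:
  fixes P Q :: "(nat \<Rightarrow> 'a::field poly poly) \<Rightarrow>\<^sub>0 'a"
  assumes "(P, Q) \<in> tensor_eq {..<g} (twisted_M p k)"
  shows "tensor_eval {..<g} dehom (free_act p g A P) = tensor_eval {..<g} dehom (free_act p g A Q)"
proof -
  have "tensor_eval {..<g} (\<lambda>i x. dehom i (twisted_subst p i A x)) (P - Q) = 0"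
    by (rule tensor_eval_span_rels[where p = p and k = k])
       (use assms in \<open>auto simp: tensor_eq_def unital_ring_hom_dehom_subst\<close>)
  then show ?thesis by (simp add: tensor_eval_free_act tensor_eval_diff)
qed

lemma rep_space_tensor_M:
  "rep_space (tensor_M p g k) = tensor_class p g k ` free_space {..<g} (twisted_M p k)"
  by (auto simp: tensor_M_def tensor_rep_def quotient_def)

text \<open>The union in \<open>tensor_rep\<close> collapses to the class of one representative as
  soon as the operation respects \<open>tensor_eq\<close>, which is checked on evaluations.\<close>

lemma rep_add_tensor_M:
  assumes "P \<in> free_space {..<g} (twisted_M p k)" "Q \<in> free_space {..<g} (twisted_M p k)"
  shows "rep_add (tensor_M p g k) (tensor_class p g k P) (tensor_class p g k Q) =
    tensor_class p g k (P + Q)"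
proof -
  note eq = equiv_tensor_eq[OF finite_lessThan, of g p k]
  show ?thesis
    unfolding tensor_M_def tensor_rep_def
    by (simp, rule UN_equiv_class2[OF eq eq _ assms])
       (auto simp: congruent2_def tensor_eq_iff tensor_eval_add free_space_add
         intro!: tensor_class_eqI)
qed

lemma rep_scale_tensor_M:
  assumes "P \<in> free_space {..<g} (twisted_M p k)"
  shows "rep_scale (tensor_M p g k) c (tensor_class p g k P) = tensor_class p g k (free_scale c P)"
  unfolding tensor_M_def tensor_rep_def
  by (simp, rule UN_equiv_class[OF equiv_tensor_eq[OF finite_lessThan] _ assms])
     (auto simp: congruent_def tensor_eq_iff tensor_eval_scale free_space_scale
       intro!: tensor_class_eqI)

lemma rep_act_tensor_M:
  fixes P :: "(nat \<Rightarrow> 'a::field poly poly) \<Rightarrow>\<^sub>0 'a"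
  assumes "P \<in> free_space {..<g} (twisted_M p k)"
  shows "rep_act (tensor_M p g k) A (tensor_class p g k P) = tensor_class p g k (free_act p g A P)"
proof -
  have "(\<lambda>P. tensor_class p g k (free_act p g A P)) respects tensor_eq {..<g} (twisted_M p k)"
  proof (rule congruentI)
    fix P Q :: "(nat \<Rightarrow> 'a poly poly) \<Rightarrow>\<^sub>0 'a"
    assume PQ: "(P, Q) \<in> tensor_eq {..<g} (twisted_M p k)"
    then have "P \<in> free_space {..<g} (twisted_M p k)" "Q \<in> free_space {..<g} (twisted_M p k)"
      by (auto simp: tensor_eq_def)
    then show "tensor_class p g k (free_act p g A P) = tensor_class p g k (free_act p g A Q)"
      by (intro tensor_class_eqI free_space_map tensor_eval_act_cong[OF PQ])
  qed
  then show ?thesis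
    unfolding tensor_M_def tensor_rep_def
    by (simp, intro UN_equiv_class[OF equiv_tensor_eq[OF finite_lessThan] _ assms])
qed

section \<open>Multiplication by a fixed tensor\<close>

lemma tensor_mult_tensor_class:
  assumes "P \<in> free_space {..<g} (twisted_M p d)" "Q \<in> free_space {..<g} (twisted_M p k)"
    and "\<forall>i<g. l i = d i + k i"
  shows "tensor_mult {..<g} (twisted_M p l) (tensor_class p g d P) (tensor_class p g k Q) =
    tensor_class p g l (free_mult {..<g} P Q)"
  unfolding tensor_mult_def
  by (rule UN_equiv_class2[OF equiv_tensor_eq[OF finite_lessThan] equiv_tensor_eq[OF finite_lessThan]
        _ assms(1,2)])
     (auto simp: congruent2_def tensor_eq_iff tensor_eval_free_mult unital_ring_hom_dehom assms(3)
       intro!: tensor_class_eqI free_space_mult)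

text \<open>Common form of both kinds of Dickson operators: \<open>d\<close> gives the factor
  degrees of the multiplier \<open>T\<close>, \<open>k\<close> those of the argument. The three
  properties are proved once for this form.\<close>

definition mult_op ::
    "nat \<Rightarrow> nat \<Rightarrow> (nat \<Rightarrow> nat) \<Rightarrow> ((nat \<Rightarrow> 'a::field poly poly) \<Rightarrow>\<^sub>0 'a) \<Rightarrow> (nat \<Rightarrow> nat) \<Rightarrow>
     'a tensor \<Rightarrow> 'a tensor" where
  "mult_op p g d T k =
     tensor_mult {..<g} (twisted_M p (\<lambda>i. d i + k i)) (tensor_class p g d T)"

lemma mult_op_tensor_class:
  assumes "T \<in> free_space {..<g} (twisted_M p d)" "P \<in> free_space {..<g} (twisted_M p k)"
  shows "mult_op p g d T k (tensor_class p g k P) =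
    tensor_class p g (\<lambda>i. d i + k i) (free_mult {..<g} T P)"
  unfolding mult_op_def by (rule tensor_mult_tensor_class[OF assms]) simp

text \<open>The action is multiplicative on factorwise products, so acting on T times P scales T by
  \<open>det A ^ n\<close> and acts on P; the determinant twist of the source supplies the same
  scalar. Linearity is distributivity after evaluation.\<close>

lemma mult_op_intertwining:
  fixes T :: "(nat \<Rightarrow> 'a::field poly poly) \<Rightarrow>\<^sub>0 'a"
  assumes T: "T \<in> free_space {..<g} (twisted_M p d)"
    and equivariant: "\<And>A :: 'a ^ 2 ^ 2. A \<in> G \<Longrightarrow>
      tensor_eval {..<g} dehom (free_act p g A T) =
      const_mpoly (det A ^ n) * tensor_eval {..<g} dehom T"
  shows "intertwining G (det_twist n (tensor_M p g k)) (tensor_M p g (\<lambda>i. d i + k i))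
    (mult_op p g d T k)"
proof -
  let ?ev = "tensor_eval {..<g} dehom :: _ \<Rightarrow> 'a mpoly_ring"
  note mult = mult_op_tensor_class[OF T]
  note ev_mult = tensor_eval_free_mult[of dehom "{..<g}", OF unital_ring_hom_dehom]
  have act_mult: "?ev (free_act p g A (free_mult {..<g} P Q)) =
      ?ev (free_act p g A P) * ?ev (free_act p g A Q)" for A P Q
    unfolding tensor_eval_free_act
    by (rule tensor_eval_free_mult) (rule unital_ring_hom_dehom_subst)
  let ?F = "free_space {..<g} (twisted_M p k)" and ?m = "free_mult {..<g} T"
  let ?M = "mult_op p g d T k" and ?l = "\<lambda>i. d i + k i"
  have m: "?m P \<in> free_space {..<g} (twisted_M p ?l)" if "P \<in> ?F" for P
    using free_space_mult[OF T that] by simp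
  have "?M (tensor_class p g k P) \<in> rep_space (tensor_M p g ?l)" if "P \<in> ?F" for P
    using mult[OF that] m[OF that] by (auto simp: rep_space_tensor_M)
  moreover have "?M (tensor_class p g k (P + Q)) = tensor_class p g ?l (?m P + ?m Q)"
    if "P \<in> ?F" "Q \<in> ?F" for P Q
    unfolding mult[OF free_space_add[OF that]]
    by (rule tensor_class_eqI)
       (simp_all add: m free_space_add that ev_mult tensor_eval_add distrib_left)
  moreover have "?M (tensor_class p g k (free_scale c P)) = tensor_class p g ?l (free_scale c (?m P))"
    if "P \<in> ?F" for P c
    unfolding mult[OF free_space_scale[OF that]]
    by (rule tensor_class_eqI)
       (simp_all add: m free_space_scale that ev_mult tensor_eval_scale mult.left_commute)
  moreover have "?M (tensor_class p g k (free_scale (det A ^ n) (free_act p g A P))) =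
      tensor_class p g ?l (free_act p g A (?m P))" if "A \<in> G" "P \<in> ?F" for A P
    unfolding mult[OF free_space_scale[OF free_space_map[OF that(2)]]]
    by (rule tensor_class_eqI)
       (simp_all add: m free_space_scale free_space_map that ev_mult act_mult tensor_eval_scale
         equivariant mult_ac)
  ultimately show ?thesis
    unfolding intertwining_def
    by (simp add: det_twist_def rep_space_tensor_M rep_add_tensor_M rep_scale_tensor_M
        rep_act_tensor_M mult m free_space_map)
qed

text \<open>Classes are equal when their evaluations are, and the nonzero evaluation of
  \<open>T\<close> cancels in an integral domain.\<close>

lemma mult_op_inj:
  fixes T :: "(nat \<Rightarrow> 'a::field poly poly) \<Rightarrow>\<^sub>0 'a"
  assumes T: "T \<in> free_space {..<g} (twisted_M p d)"
    and nz: "tensor_eval {..<g} dehom T \<noteq> 0"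
  shows "inj_on (mult_op p g d T k) (rep_space (det_twist n (tensor_M p g k)))"
proof (rule inj_onI)
  fix x y
  assume "x \<in> rep_space (det_twist n (tensor_M p g k))" "y \<in> rep_space (det_twist n (tensor_M p g k))"
    and eq: "mult_op p g d T k x = mult_op p g d T k y"
  then obtain P Q where P: "P \<in> free_space {..<g} (twisted_M p k)" "x = tensor_class p g k P"
      and Q: "Q \<in> free_space {..<g} (twisted_M p k)" "y = tensor_class p g k Q"
    by (auto simp: det_twist_def rep_space_tensor_M)
  have TP: "free_mult {..<g} T P \<in> free_space {..<g} (twisted_M p (\<lambda>i. d i + k i))"
      "free_mult {..<g} T Q \<in> free_space {..<g} (twisted_M p (\<lambda>i. d i + k i))"
    using free_space_mult[OF T P(1)] free_space_mult[OF T Q(1)] by auto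
  have "tensor_eval {..<g} dehom T * tensor_eval {..<g} dehom P =
      tensor_eval {..<g} dehom T * tensor_eval {..<g} dehom Q"
    using eq tensor_class_eq_iff[OF TP]
    by (simp add: P Q mult_op_tensor_class[OF T] tensor_eval_free_mult unital_ring_hom_dehom)
  then show "x = y" using P Q nz by (simp add: tensor_class_eq_iff)
qed

lemma mult_op_commute:
  fixes T :: "(nat \<Rightarrow> 'a::field poly poly) \<Rightarrow>\<^sub>0 'a"
  assumes T: "T \<in> free_space {..<g} (twisted_M p d)" and T': "T' \<in> free_space {..<g} (twisted_M p d')"
    and x: "x \<in> rep_space (tensor_M p g k)"
  shows "mult_op p g d T (\<lambda>i. d' i + k i) (mult_op p g d' T' k x) =
    mult_op p g d' T' (\<lambda>i. d i + k i) (mult_op p g d T k x)"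
proof -
  obtain P where P: "P \<in> free_space {..<g} (twisted_M p k)" "x = tensor_class p g k P"
    using x by (auto simp: rep_space_tensor_M)
  have TP: "free_mult {..<g} T P \<in> free_space {..<g} (twisted_M p (\<lambda>i. d i + k i))"
      "free_mult {..<g} T' P \<in> free_space {..<g} (twisted_M p (\<lambda>i. d' i + k i))"
    using free_space_mult[OF T P(1)] free_space_mult[OF T' P(1)] by auto
  \<comment> \<open>The composites come with the degrees \<open>d + (d' + k)\<close> and
    \<open>d' + (d + k)\<close>. Both are compared in the first form;
    \<open>add.left_commute\<close> identifies them at the end.\<close>
  have "tensor_class p g (\<lambda>i. d i + (d' i + k i)) (free_mult {..<g} T (free_mult {..<g} T' P)) =
      tensor_class p g (\<lambda>i. d i + (d' i + k i)) (free_mult {..<g} T' (free_mult {..<g} T P))"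
  proof (rule tensor_class_eqI)
    show "free_mult {..<g} T (free_mult {..<g} T' P) \<in>
        free_space {..<g} (twisted_M p (\<lambda>i. d i + (d' i + k i)))"
      by (rule free_space_mult[OF T TP(2)]) simp
    show "free_mult {..<g} T' (free_mult {..<g} T P) \<in>
        free_space {..<g} (twisted_M p (\<lambda>i. d i + (d' i + k i)))"
      by (rule free_space_mult[OF T' TP(1)]) simp
  qed (simp add: tensor_eval_free_mult unital_ring_hom_dehom mult_ac)
  then show ?thesis
    by (simp add: P mult_op_tensor_class[OF T] mult_op_tensor_class[OF T'] TP
        add.left_commute[of "d _"])
qed

section \<open>The Dickson elements\<close>

text \<open>Translation by 1 permutes the field; comparing the two sums of all elements shows that
  the cardinality is zero in the field. The characteristic is then a prime dividing p^g.\<close>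

lemma finite_field_CHAR:
  assumes "prime p" "CARD('a::{field,finite}) = p ^ g"
  shows "CHAR('a) = p"
proof -
  have "(\<Sum>x\<in>(UNIV :: 'a set). x + 1) = (\<Sum>x\<in>UNIV. x)"
    by (rule sum.reindex_bij_witness[of _ "\<lambda>x. x - 1" "\<lambda>x. x + 1"]) auto
  then have "of_nat CARD('a) = (0 :: 'a)" by (simp add: sum.distrib)
  then have "CHAR('a) dvd p ^ g" using assms(2) of_nat_eq_0_iff_char_dvd by metis
  moreover have "prime CHAR('a)"
    by (intro prime_CHAR_semidom finite_imp_CHAR_pos finite)
  ultimately show ?thesis
    using assms(1) by (metis prime_dvd_power primes_dvd_imp_eq)
qed

text \<open>Multiplication by a nonzero x permutes the nonzero elements; comparing the two products
  of all of them gives x^(q-1) = 1.\<close>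

lemma finite_field_power_CARD: "x ^ CARD('a) = (x :: 'a::{field,finite})"
proof (cases "x = 0")
  case False
  let ?U = "UNIV - {0 :: 'a}"
  have "(\<Prod>y\<in>?U. y) = (\<Prod>y\<in>?U. x * y)"
    by (rule prod.reindex_bij_witness[of _ "\<lambda>y. x * y" "\<lambda>y. y / x"]) (use False in auto)
  also have "\<dots> = x ^ card ?U * (\<Prod>y\<in>?U. y)" by (simp add: prod.distrib)
  finally have "x ^ card ?U = 1" by simp
  moreover have "CARD('a) = Suc (card ?U)" by (rule card.remove) simp_all
  ultimately show ?thesis by (simp only: power_Suc mult_1_right)
qed simp

lemma finite_field_power_CARD_power: "x ^ (CARD('a) * n) = (x ^ n :: 'a::{field,finite})"
  by (simp add: power_mult finite_field_power_CARD)

text \<open>Makes the Frobenius power additive on the polynomial ring. Constant coefficients detect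
  whether a natural number vanishes.\<close>

lemma CHAR_mpoly: "CHAR('a::field mpoly_ring) = CHAR('a)"
proof (rule CHAR_eqI)
  have eq: "(of_nat n :: 'a mpoly_ring) = const_mpoly (of_nat n)" for n by simp
  show "of_nat CHAR('a) = (0 :: 'a mpoly_ring)" by (subst eq) (simp only: of_nat_CHAR single_zero)
  show "CHAR('a) dvd n" if "of_nat n = (0 :: 'a mpoly_ring)" for n
  proof -
    have "Poly_Mapping.lookup (const_mpoly (of_nat n :: 'a)) 0 = 0"
      by (simp only: that lookup_zero flip: eq)
    then show ?thesis by (simp only: lookup_single_eq of_nat_eq_0_iff_char_dvd)
  qed
qed

lemma frob_add:
  fixes x y :: "'a::{field,finite} mpoly_ring"
  assumes "prime p" "CARD('a) = p ^ g"
  shows "(x + y) ^ p ^ n = x ^ p ^ n + y ^ p ^ n"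
  by (rule freshmans_dream') (use assms in \<open>simp_all add: CHAR_mpoly finite_field_CHAR[OF assms]\<close>)

lemma frob_det:
  fixes A :: "'a::{field,finite} ^ 2 ^ 2"
  assumes "prime p" "CARD('a) = p ^ g"
  shows "det A ^ p ^ n = A$1$1 ^ p ^ n * A$2$2 ^ p ^ n - A$1$2 ^ p ^ n * A$2$1 ^ p ^ n"
proof -
  \<comment> \<open>The additivity of Frobenius concerns sums, so the subtracted product is added
    back; the base on the left is \<open>A$1$1 * A$2$2\<close>.\<close>
  have "(det A + A$1$2 * A$2$1) ^ p ^ n = det A ^ p ^ n + (A$1$2 * A$2$1) ^ p ^ n"
    by (rule freshmans_dream') (use assms in \<open>simp_all add: finite_field_CHAR[OF assms]\<close>)
  then show ?thesis by (simp add: det_2 power_mult_distrib)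
qed

section \<open>Linear forms under the group action\<close>

lemma dehom_twisted_subst_polyX:
  "dehom i (twisted_subst p i A polyX) =
    const_mpoly (A$1$1 ^ p ^ i) * var i + const_mpoly (A$2$1 ^ p ^ i)"
  by (simp add: twisted_subst_def unital_ring_hom.hom_add[OF unital_ring_hom_dehom]
      unital_ring_hom.hom_mult[OF unital_ring_hom_dehom])

lemma dehom_twisted_subst_polyY:
  "dehom i (twisted_subst p i A polyY) =
    const_mpoly (A$1$2 ^ p ^ i) * var i + const_mpoly (A$2$2 ^ p ^ i)"
  by (simp add: twisted_subst_def unital_ring_hom.hom_add[OF unital_ring_hom_dehom]
      unital_ring_hom.hom_mult[OF unital_ring_hom_dehom])

lemma const_mpoly_power: "const_mpoly c ^ n = const_mpoly (c ^ n)"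
  by (rule unital_ring_hom.hom_power[OF unital_ring_hom_const_mpoly, symmetric])

text \<open>Brings the coefficients of a form on the factor j to the twist of the factor i, so that
  both factors of a Dickson element see the same twisted matrix.\<close>

lemma linear_form_frob_power:
  fixes b c :: "'a::{field,finite}"
  assumes "prime p" "CARD('a) = p ^ g"
    and "\<And>x :: 'a. x ^ (p ^ j * p ^ n) = x ^ p ^ i"
  shows "(const_mpoly (b ^ p ^ j) * var v + const_mpoly (c ^ p ^ j)) ^ p ^ n =
    const_mpoly (b ^ p ^ i) * var v ^ p ^ n + const_mpoly (c ^ p ^ i)"
  by (simp add: frob_add[OF assms(1,2)] power_mult_distrib const_mpoly_power assms(3)
      flip: power_mult)

text \<open>Multiplicativity of the determinant: the matrix with rows (x, 1) and (y, 1), of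
  determinant x - y, is multiplied on the right by the matrix with rows (a, b) and (c, d).\<close>

lemma linear_form_determinant:
  fixes x y :: "'a::field mpoly_ring"
  shows "(const_mpoly a * x + const_mpoly c) * (const_mpoly b * y + const_mpoly d) -
    (const_mpoly b * x + const_mpoly d) * (const_mpoly a * y + const_mpoly c) =
    const_mpoly (a * d - b * c) * (x - y)"
proof -
  have "const_mpoly (a * d - b * c) = const_mpoly a * const_mpoly d - const_mpoly b * const_mpoly c"
    by (simp add: unital_ring_hom.hom_diff[OF unital_ring_hom_const_mpoly]
        unital_ring_hom.hom_mult[OF unital_ring_hom_const_mpoly])
  then show ?thesis by (simp only:) (simp add: algebra_simps)
qed

text \<open>The two sides are monomials, whose exponent vectors are compared at \<open>i\<close>.
  Different variables serve \<open>Theta2\<close>, a power other than 1 of the same variable serves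
  \<open>Theta1\<close>.\<close>

lemma var_neq:
  assumes "i \<noteq> j \<or> n \<noteq> 1"
  shows "var i - var j ^ n \<noteq> (0 :: 'a::field mpoly_ring)"
proof
  assume "var i - var j ^ n = (0 :: 'a mpoly_ring)"
  then have "var i ^ 1 = (var j ^ n :: 'a mpoly_ring)" by simp
  then have "Poly_Mapping.keys (var i ^ 1 :: 'a mpoly_ring) = Poly_Mapping.keys (var j ^ n :: 'a mpoly_ring)"
    by (rule arg_cong)
  then have "Poly_Mapping.single i 1 = Poly_Mapping.single j n"
    unfolding var_power keys_single by simp
  then have "(1 when i = i) = (n when j = i)" by (metis lookup_single)
  then show False using assms by (auto simp: when_def split: if_splits)
qed

section \<open>Representatives of the Dickson elements and their transformation\<close>

definition Theta2_rep :: "nat \<Rightarrow> nat \<Rightarrow> nat \<Rightarrow> nat \<Rightarrow> (nat \<Rightarrow> 'a::field poly poly) \<Rightarrow>\<^sub>0 'a" where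
  "Theta2_rep p g \<alpha> \<beta> =
     gen (\<lambda>i\<in>{..<g}. if i = \<alpha> then polyX else if i = (\<alpha> + \<beta>) mod g then polyY ^ p ^ (g - \<beta>) else 1) -
     gen (\<lambda>i\<in>{..<g}. if i = \<alpha> then polyY else if i = (\<alpha> + \<beta>) mod g then polyX ^ p ^ (g - \<beta>) else 1)"

definition Theta1_rep :: "nat \<Rightarrow> nat \<Rightarrow> nat \<Rightarrow> (nat \<Rightarrow> 'a::field poly poly) \<Rightarrow>\<^sub>0 'a" where
  "Theta1_rep p g \<alpha> =
     gen (\<lambda>i\<in>{..<g}. if i = \<alpha> then polyX * polyY ^ p ^ g - polyX ^ p ^ g * polyY else 1)"

text \<open>Ensures that the two nontrivial factors of a Dickson element sit at different indices:
  without wrapping the index grows, with wrapping it becomes \<alpha> + \<beta> - g, below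
  \<alpha>.\<close>

lemma mod_shift_neq:
  assumes "\<alpha> < g" "0 < \<beta>" "\<beta> < g"
  shows "(\<alpha> + \<beta>) mod g \<noteq> (\<alpha>::nat)"
  using assms by (cases "\<alpha> + \<beta> < g") (auto simp: mod_if)

lemma Theta2_rep_free_space:
  assumes "\<alpha> < g" "0 < \<beta>" "\<beta> < g"
  shows "Theta2_rep p g \<alpha> \<beta> \<in> free_space {..<g} (twisted_M p (Theta2_deg p g \<alpha> \<beta> (\<lambda>_. 0)))"
  unfolding Theta2_rep_def gen_def
  using mod_shift_neq[OF assms] homog_power[OF homog_polyX, of "p ^ (g - \<beta>)"]
    homog_power[OF homog_polyY, of "p ^ (g - \<beta>)"] homog_polyX homog_polyY
  by (intro free_space_diff free_space_single)
     (auto simp: Theta2_deg_def homog_one)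

lemma Theta1_rep_free_space:
  "Theta1_rep p g \<alpha> \<in> free_space {..<g} (twisted_M p (Theta1_deg p g \<alpha> (\<lambda>_. 0)))"
  unfolding Theta1_rep_def gen_def
  using homog_mult[OF homog_polyX homog_power[OF homog_polyY, of "p ^ g"]]
    homog_mult[OF homog_power[OF homog_polyX, of "p ^ g"] homog_polyY]
  by (intro free_space_single)
     (auto simp: Theta1_deg_def homog_one intro: homog_diff)

lemma prod_two_factors:
  fixes h :: "nat \<Rightarrow> 'v::one \<Rightarrow> 'c::comm_monoid_mult"
  assumes "\<alpha> < g" "\<gamma> < g" "\<gamma> \<noteq> \<alpha>" "\<And>i. h i 1 = 1"
  shows "(\<Prod>i<g. h i ((\<lambda>i\<in>{..<g}. if i = \<alpha> then u else if i = \<gamma> then v else 1) i)) = h \<alpha> u * h \<gamma> v"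
proof -
  have "(\<Prod>i<g. h i ((\<lambda>i\<in>{..<g}. if i = \<alpha> then u else if i = \<gamma> then v else 1) i)) =
      (\<Prod>i\<in>{\<alpha>, \<gamma>}. h i ((\<lambda>i\<in>{..<g}. if i = \<alpha> then u else if i = \<gamma> then v else 1) i))"
    by (rule prod.mono_neutral_right) (use assms in auto)
  then show ?thesis using assms by auto
qed

lemma prod_one_factor:
  fixes h :: "nat \<Rightarrow> 'v::one \<Rightarrow> 'c::comm_monoid_mult"
  assumes "\<alpha> < g" "\<And>i. h i 1 = 1"
  shows "(\<Prod>i<g. h i ((\<lambda>i\<in>{..<g}. if i = \<alpha> then u else 1) i)) = h \<alpha> u"
proof -
  have "(\<Prod>i<g. h i ((\<lambda>i\<in>{..<g}. if i = \<alpha> then u else 1) i)) =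
      (\<Prod>i\<in>{\<alpha>}. h i ((\<lambda>i\<in>{..<g}. if i = \<alpha> then u else 1) i))"
    by (rule prod.mono_neutral_right) (use assms in auto)
  then show ?thesis using assms by auto
qed

lemma tensor_eval_Theta2_rep:
  assumes "\<alpha> < g" "0 < \<beta>" "\<beta> < g" and h: "\<And>i. unital_ring_hom (h i)"
  shows "tensor_eval {..<g} h (Theta2_rep p g \<alpha> \<beta>) =
    h \<alpha> polyX * h ((\<alpha> + \<beta>) mod g) polyY ^ p ^ (g - \<beta>) -
    h \<alpha> polyY * h ((\<alpha> + \<beta>) mod g) polyX ^ p ^ (g - \<beta>)"
  using prod_two_factors[OF assms(1) _ mod_shift_neq[OF assms(1-3)], of h] assms(1)
  by (simp add: Theta2_rep_def tensor_eval_diff tensor_eval_gen unital_ring_hom.hom_one[OF h]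
      unital_ring_hom.hom_power[OF h])

text \<open>The second product is written with Y first, to match the shape of
  \<open>linear_form_determinant\<close>.\<close>

lemma tensor_eval_Theta1_rep:
  assumes "\<alpha> < g" and h: "\<And>i. unital_ring_hom (h i)"
  shows "tensor_eval {..<g} h (Theta1_rep p g \<alpha>) =
    h \<alpha> polyX * h \<alpha> polyY ^ p ^ g - h \<alpha> polyY * h \<alpha> polyX ^ p ^ g"
  using prod_one_factor[OF assms(1), of h]
  by (simp add: Theta1_rep_def tensor_eval_gen unital_ring_hom.hom_one[OF h]
      unital_ring_hom.hom_power[OF h] unital_ring_hom.hom_diff[OF h] unital_ring_hom.hom_mult[OF h])

text \<open>
  When \<open>\<alpha> + \<beta>\<close> does not wrap around modulo \<open>g\<close>, the exponent on the left is \<open>q \<cdot> p ^ \<alpha>\<close>.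
\<close>

lemma frob_exponent_wrap:
  fixes x :: "'a::{field,finite}"
  assumes "CARD('a) = p ^ g" "\<alpha> < g" "\<beta> < g"
  shows "x ^ (p ^ ((\<alpha> + \<beta>) mod g) * p ^ (g - \<beta>)) = x ^ p ^ \<alpha>"
proof (cases "\<alpha> + \<beta> < g")
  case True
  then have "p ^ ((\<alpha> + \<beta>) mod g) * p ^ (g - \<beta>) = CARD('a) * p ^ \<alpha>"
    using assms by (simp add: add.commute flip: power_add)
  then show ?thesis by (simp only: finite_field_power_CARD_power)
next
  case False
  \<comment> \<open>After wrapping, the index is \<alpha> + \<beta> - g, so the exponents of p add
    up to exactly \<alpha> and no factor q appears.\<close>
  then have "(\<alpha> + \<beta>) mod g + (g - \<beta>) = \<alpha>"
    using assms by (simp add: mod_if)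
  then show ?thesis by (simp flip: power_add)
qed

text \<open>The power p^(g-\<beta>) takes the coefficients on the factor \<alpha> + \<beta> to the
  twist of the factor \<alpha>. The determinant identity then applies with y the p^(g-\<beta>)-th
  power of the second variable, and the determinant of the twisted matrix is
  \<open>det A ^ p ^ \<alpha>\<close>.\<close>

lemma Theta2_rep_equivariant:
  fixes A :: "'a::{field,finite} ^ 2 ^ 2"
  assumes "prime p" "CARD('a) = p ^ g" "\<alpha> < g" "0 < \<beta>" "\<beta> < g"
  shows "tensor_eval {..<g} dehom (free_act p g A (Theta2_rep p g \<alpha> \<beta>)) =
    const_mpoly (det A ^ p ^ \<alpha>) * tensor_eval {..<g} dehom (Theta2_rep p g \<alpha> \<beta>)"
  unfolding tensor_eval_free_act tensor_eval_Theta2_rep[OF assms(3-5) unital_ring_hom_dehom_subst]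
    tensor_eval_Theta2_rep[OF assms(3-5) unital_ring_hom_dehom]
    dehom_twisted_subst_polyX dehom_twisted_subst_polyY
    linear_form_frob_power[OF assms(1,2) frob_exponent_wrap[OF assms(2,3,5)]]
    linear_form_determinant
  by (simp add: frob_det[OF assms(1,2)])

text \<open>Same computation within the single factor \<alpha>: the q-th power fixes the
  coefficients, so y is the q-th power of x.\<close>

lemma Theta1_rep_equivariant:
  fixes A :: "'a::{field,finite} ^ 2 ^ 2"
  assumes "prime p" "CARD('a) = p ^ g" "\<alpha> < g"
  shows "tensor_eval {..<g} dehom (free_act p g A (Theta1_rep p g \<alpha>)) =
    const_mpoly (det A ^ p ^ \<alpha>) * tensor_eval {..<g} dehom (Theta1_rep p g \<alpha>)"
proof -
  have "x ^ (p ^ \<alpha> * p ^ g) = x ^ p ^ \<alpha>" for x :: 'a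
    using finite_field_power_CARD_power[of x "p ^ \<alpha>"] assms(2) by (simp add: mult.commute)
  note linear_form_frob_power[OF assms(1,2) this]
  then show ?thesis
    unfolding tensor_eval_free_act tensor_eval_Theta1_rep[OF assms(3) unital_ring_hom_dehom_subst]
      tensor_eval_Theta1_rep[OF assms(3) unital_ring_hom_dehom]
      dehom_twisted_subst_polyX dehom_twisted_subst_polyY
    by (simp add: linear_form_determinant frob_det[OF assms(1,2)])
qed

lemma Theta2_rep_nonzero:
  assumes "\<alpha> < g" "0 < \<beta>" "\<beta> < g"
  shows "tensor_eval {..<g} dehom (Theta2_rep p g \<alpha> \<beta>) \<noteq> (0 :: 'a::field mpoly_ring)"
  unfolding tensor_eval_Theta2_rep[OF assms unital_ring_hom_dehom]
  using var_neq[of \<alpha> "(\<alpha> + \<beta>) mod g"] mod_shift_neq[OF assms] by simp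

text \<open>From \<open>\<alpha> < g\<close> the exponent g is positive, so p^g > 1 and the two
  monomials in the same variable differ.\<close>

lemma Theta1_rep_nonzero:
  assumes "\<alpha> < g" "p > 1"
  shows "tensor_eval {..<g} dehom (Theta1_rep p g \<alpha>) \<noteq> (0 :: 'a::field mpoly_ring)"
  unfolding tensor_eval_Theta1_rep[OF assms(1) unital_ring_hom_dehom]
  using var_neq[of \<alpha> \<alpha> "p ^ g"] assms one_less_power[OF assms(2), of g] by simp

text \<open>Rewrites the target degrees as those of the Dickson element plus \<open>k\<close>, the
  form that \<open>mult_op\<close> produces.\<close>

lemma Theta2_deg_split:
  assumes "\<alpha> < g" "0 < \<beta>" "\<beta> < g"
  shows "Theta2_deg p g \<alpha> \<beta> k = (\<lambda>i. Theta2_deg p g \<alpha> \<beta> (\<lambda>_. 0) i + k i)"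
  using mod_shift_neq[OF assms] by (auto simp: Theta2_deg_def)

lemma Theta1_deg_split: "Theta1_deg p g \<alpha> k = (\<lambda>i. Theta1_deg p g \<alpha> (\<lambda>_. 0) i + k i)"
  by (auto simp: Theta1_deg_def)

text \<open>An equality of functions of the degrees, so that it also rewrites operators taken at the
  shifted degrees in the commutation relations.\<close>

lemma Theta2_eq:
  assumes "\<alpha> < g" "0 < \<beta>" "\<beta> < g"
  shows "Theta2 p g \<alpha> \<beta> = mult_op p g (Theta2_deg p g \<alpha> \<beta> (\<lambda>_. 0)) (Theta2_rep p g \<alpha> \<beta>)"
  unfolding Theta2_def Theta2_elt_def Theta2_rep_def mult_op_def
  by (rule ext) (subst Theta2_deg_split[OF assms], rule refl)

lemma Theta1_eq: "Theta1 p g \<alpha> = mult_op p g (Theta1_deg p g \<alpha> (\<lambda>_. 0)) (Theta1_rep p g \<alpha>)"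
  unfolding Theta1_def Theta1_elt_def Theta1_rep_def mult_op_def
  by (rule ext) (subst Theta1_deg_split, rule refl)

theorem theorem3p12:
  fixes p g :: nat and k :: "nat \<Rightarrow> nat"
  assumes "prime p" and "g > 1" and "CARD('a::{field,finite}) = p ^ g"
  shows
    "(\<forall>\<alpha>\<in>{0..g-1}. \<forall>\<beta>\<in>{1..g-1}.
        intertwining (GL2 :: ('a ^ 2 ^ 2) set)
          (det_twist (p ^ \<alpha>) (tensor_M p g k))
          (tensor_M p g (k(\<alpha> := k \<alpha> + 1,
             (\<alpha> + \<beta>) mod g := k ((\<alpha> + \<beta>) mod g) + p ^ (g - \<beta>))))
          (Theta2 p g \<alpha> \<beta> k) \<and>
        inj_on (Theta2 p g \<alpha> \<beta> k)
          (rep_space (det_twist (p ^ \<alpha>) (tensor_M p g k :: ('a, 'a ^ 2 ^ 2, 'a tensor) rep)))) \<and>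
     (\<forall>\<alpha>\<in>{0..g-1}.
        intertwining (GL2 :: ('a ^ 2 ^ 2) set)
          (det_twist (p ^ \<alpha>) (tensor_M p g k))
          (tensor_M p g (k(\<alpha> := k \<alpha> + (p ^ g + 1))))
          (Theta1 p g \<alpha> k) \<and>
        inj_on (Theta1 p g \<alpha> k)
          (rep_space (det_twist (p ^ \<alpha>) (tensor_M p g k :: ('a, 'a ^ 2 ^ 2, 'a tensor) rep)))) \<and>
     (\<forall>x\<in>rep_space (tensor_M p g k :: ('a, 'a ^ 2 ^ 2, 'a tensor) rep).
        (\<forall>\<alpha>\<in>{0..g-1}. \<forall>\<beta>\<in>{1..g-1}. \<forall>\<alpha>'\<in>{0..g-1}. \<forall>\<beta>'\<in>{1..g-1}.
           Theta2 p g \<alpha> \<beta> (Theta2_deg p g \<alpha>' \<beta>' k) (Theta2 p g \<alpha>' \<beta>' k x) =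
           Theta2 p g \<alpha>' \<beta>' (Theta2_deg p g \<alpha> \<beta> k) (Theta2 p g \<alpha> \<beta> k x)) \<and>
        (\<forall>\<alpha>\<in>{0..g-1}. \<forall>\<beta>\<in>{1..g-1}. \<forall>\<alpha>'\<in>{0..g-1}.
           Theta2 p g \<alpha> \<beta> (Theta1_deg p g \<alpha>' k) (Theta1 p g \<alpha>' k x) =
           Theta1 p g \<alpha>' (Theta2_deg p g \<alpha> \<beta> k) (Theta2 p g \<alpha> \<beta> k x)) \<and>
        (\<forall>\<alpha>\<in>{0..g-1}. \<forall>\<alpha>'\<in>{0..g-1}.
           Theta1 p g \<alpha> (Theta1_deg p g \<alpha>' k) (Theta1 p g \<alpha>' k x) =
           Theta1 p g \<alpha>' (Theta1_deg p g \<alpha> k) (Theta1 p g \<alpha> k x)))"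
proof -
  have p1: "p > 1" using assms(1) by (rule prime_gt_1_nat)
  have \<alpha>: "\<alpha> < g" if "\<alpha> \<in> {0..g-1}" for \<alpha> using that assms(2) by auto
  have \<beta>: "0 < \<beta>" "\<beta> < g" if "\<beta> \<in> {1..g-1}" for \<beta> using that assms(2) by auto
  \<comment> \<open>\<open>\<beta>\<close> consists of two facts, each with its own membership
    premise, hence the repeated index in \<open>that(1,2,2)\<close>. Fixing \<open>k\<close> keeps
    \<open>deg2\<close> from rewriting the zero degrees on its own right-hand side.\<close>
  note eq2 = Theta2_eq[OF \<alpha> \<beta>] and deg2 = Theta2_deg_split[OF \<alpha> \<beta>, of _ _ p k]
  note rep2 = Theta2_rep_free_space[OF \<alpha> \<beta>] and rep1 = Theta1_rep_free_space
  have "intertwining (GL2 :: ('a ^ 2 ^ 2) set) (det_twist (p ^ \<alpha>) (tensor_M p g k))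
      (tensor_M p g (k(\<alpha> := k \<alpha> + 1,
         (\<alpha> + \<beta>) mod g := k ((\<alpha> + \<beta>) mod g) + p ^ (g - \<beta>)))) (Theta2 p g \<alpha> \<beta> k)"
    if "\<alpha> \<in> {0..g-1}" "\<beta> \<in> {1..g-1}" for \<alpha> \<beta>
    \<comment> \<open>The explicit function update in the target is folded back into
      \<open>Theta2_deg\<close> before being split into a sum.\<close>
    unfolding Theta2_deg_def[symmetric] eq2[OF that(1,2,2)] deg2[OF that(1,2,2)]
    by (rule mult_op_intertwining[OF rep2[OF that(1,2,2)]
          Theta2_rep_equivariant[OF assms(1,3) \<alpha>[OF that(1)] \<beta>[OF that(2)]]])
  moreover have "inj_on (Theta2 p g \<alpha> \<beta> k)
      (rep_space (det_twist (p ^ \<alpha>) (tensor_M p g k :: ('a, 'a ^ 2 ^ 2, 'a tensor) rep)))"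
    if "\<alpha> \<in> {0..g-1}" "\<beta> \<in> {1..g-1}" for \<alpha> \<beta>
    unfolding eq2[OF that(1,2,2)]
    by (rule mult_op_inj[OF rep2[OF that(1,2,2)] Theta2_rep_nonzero[OF \<alpha>[OF that(1)] \<beta>[OF that(2)]]])
  moreover have "intertwining (GL2 :: ('a ^ 2 ^ 2) set) (det_twist (p ^ \<alpha>) (tensor_M p g k))
      (tensor_M p g (k(\<alpha> := k \<alpha> + (p ^ g + 1)))) (Theta1 p g \<alpha> k)"
    if "\<alpha> \<in> {0..g-1}" for \<alpha>
    unfolding Theta1_deg_def[of p g \<alpha> k, symmetric] Theta1_eq Theta1_deg_split[of p g \<alpha> k]
    by (rule mult_op_intertwining[OF rep1 Theta1_rep_equivariant[OF assms(1,3) \<alpha>[OF that]]])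
  moreover have "inj_on (Theta1 p g \<alpha> k)
      (rep_space (det_twist (p ^ \<alpha>) (tensor_M p g k :: ('a, 'a ^ 2 ^ 2, 'a tensor) rep)))"
    if "\<alpha> \<in> {0..g-1}" for \<alpha>
    unfolding Theta1_eq
    using assms(2) by (intro mult_op_inj[OF rep1 Theta1_rep_nonzero[OF \<alpha>[OF that] p1]])
  moreover have "Theta2 p g \<alpha> \<beta> (Theta2_deg p g \<alpha>' \<beta>' k) (Theta2 p g \<alpha>' \<beta>' k x) =
      Theta2 p g \<alpha>' \<beta>' (Theta2_deg p g \<alpha> \<beta> k) (Theta2 p g \<alpha> \<beta> k x)"
    if "x \<in> rep_space (tensor_M p g k :: ('a, 'a ^ 2 ^ 2, 'a tensor) rep)"
      "\<alpha> \<in> {0..g-1}" "\<beta> \<in> {1..g-1}" "\<alpha>' \<in> {0..g-1}" "\<beta>' \<in> {1..g-1}" for x \<alpha> \<beta> \<alpha>' \<beta>'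
    unfolding eq2[OF that(2,3,3)] eq2[OF that(4,5,5)] deg2[OF that(2,3,3)] deg2[OF that(4,5,5)]
    by (rule mult_op_commute[OF rep2[OF that(2,3,3)] rep2[OF that(4,5,5)] that(1)])
  moreover have "Theta2 p g \<alpha> \<beta> (Theta1_deg p g \<alpha>' k) (Theta1 p g \<alpha>' k x) =
      Theta1 p g \<alpha>' (Theta2_deg p g \<alpha> \<beta> k) (Theta2 p g \<alpha> \<beta> k x)"
    if "x \<in> rep_space (tensor_M p g k :: ('a, 'a ^ 2 ^ 2, 'a tensor) rep)"
      "\<alpha> \<in> {0..g-1}" "\<beta> \<in> {1..g-1}" "\<alpha>' \<in> {0..g-1}" for x \<alpha> \<beta> \<alpha>'
    unfolding eq2[OF that(2,3,3)] Theta1_eq deg2[OF that(2,3,3)] Theta1_deg_split[of p g \<alpha>' k]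
    by (rule mult_op_commute[OF rep2[OF that(2,3,3)] rep1 that(1)])
  moreover have "Theta1 p g \<alpha> (Theta1_deg p g \<alpha>' k) (Theta1 p g \<alpha>' k x) =
      Theta1 p g \<alpha>' (Theta1_deg p g \<alpha> k) (Theta1 p g \<alpha> k x)"
    if "x \<in> rep_space (tensor_M p g k :: ('a, 'a ^ 2 ^ 2, 'a tensor) rep)" for x \<alpha> \<alpha>'
    unfolding Theta1_eq Theta1_deg_split[of p g \<alpha> k] Theta1_deg_split[of p g \<alpha>' k]
    by (rule mult_op_commute[OF rep1 rep1 that(1)])
  ultimately show ?thesis by (intro conjI ballI)
qed

end
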